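(* Let $n\ge 1$ and let $\boldsymbol{p} > \boldsymbol{0}$ and $\boldsymbol{q} > \boldsymbol{0}$ be $n$-dimensional stochastic vectors. Then the eigenvalues of the matrix $\overline{U}$ corresponding to $(\boldsymbol{p},\boldsymbol{q})$ are $\overline{u}_{11},\overline{u}_{22},\ldots,\overline{u}_{nn}$, and the eigenvalues of the matrix $\overline{V}$ corresponding to $(\boldsymbol{p},\boldsymbol{q})$ are $\overline{v}_{11},\overline{v}_{22},\ldots,\overline{v}_{nn}$.
   Context: Inequalities between vectors are entrywise; $\boldsymbol{1}$ is the all-ones vector, $\boldsymbol{0}$ the zero vector. A vector $\boldsymbol{a}\in\mathbb{R}^n$ is stochastic if $\boldsymbol{a}^\top\boldsymbol{1}=1$ and $\boldsymbol{a}\ge\boldsymbol{0}$. Write $[c]^+=\max\{c,0\}$ and $[c]^-=\min\{c,0\}$. A list of $n$ eigenvalues of an $n\times n$ matrix is understood with algebraic multiplicity. The matrices $\overline{U},\overline{V}\in\mathbb{R}^{n\times n}$ corresponding to $(\boldsymbol{p},\boldsymbol{q})$ have entries $$\overline{u}_{ij}=\begin{cases}1-[1-p_i/q_i]^+, & i=j,\\ 0, & i\ne j \text{ and } \boldsymbol{p}=\boldsymbol{q},\\ \dfrac{[1-p_i/q_i]^+\,[p_j-q_j]^+}{\sum_{k=1}^n[p_k-q_k]^+}, & i\neq j\text{ and }\boldsymbol{p}\ne\boldsymbol{q},\end{cases}$$ $$\overline{v}_{ij}=\begin{cases}1-[1-q_i/p_i]^-, & i=j,\\ 0, & i\ne j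 \text{ and } \boldsymbol{p}=\boldsymbol{q},\\ \dfrac{[1-q_i/p_i]^-\,[p_j-q_j]^+}{\sum_{k=1}^n[p_k-q_k]^+}, & i\neq j\text{ and }\boldsymbol{p}\ne\boldsymbol{q}.\end{cases}$$ *)

theory Defs
  imports
    Complex_Main
    "HOL-Computational_Algebra.Fundamental_Theorem_Algebra"
    "Jordan_Normal_Form.Char_Poly"
begin

definition stochastic_vec :: "real vec \<Rightarrow> bool" where
  "stochastic_vec a \<longleftrightarrow>
     (\<Sum>i<dim_vec a. a $ i) = 1 \<and> (\<forall>i<dim_vec a. a $ i \<ge> 0)"

(* Strict entrywise positivity.  The order \<open><\<close> of type vec is not used here: it is the
   strict part of the entrywise order \<open>\<le>\<close>, hence weaker than entrywise \<open><\<close>. *)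
definition positive_vec :: "real vec \<Rightarrow> bool" where
  "positive_vec a \<longleftrightarrow> (\<forall>i<dim_vec a. a $ i > 0)"

definition pos_part :: "real \<Rightarrow> real" where
  "pos_part c = max c 0"

(* The negative part keeps its sign: it is \<open>\<le> 0\<close>. *)
definition neg_part :: "real \<Rightarrow> real" where
  "neg_part c = min c 0"

definition U_bar :: "real vec \<Rightarrow> real vec \<Rightarrow> real mat" where
  "U_bar p q = mat (dim_vec p) (dim_vec p) (\<lambda>(i, j).
     if i = j then 1 - pos_part (1 - p $ i / q $ i)
     else if p = q then 0
     else pos_part (1 - p $ i / q $ i) * pos_part (p $ j - q $ j)
            / (\<Sum>k<dim_vec p. pos_part (p $ k - q $ k)))"

definition V_bar :: "real vec \<Rightarrow> real vec \<Rightarrow> real mat" where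
  "V_bar p q = mat (dim_vec p) (dim_vec p) (\<lambda>(i, j).
     if i = j then 1 - neg_part (1 - q $ i / p $ i)
     else if p = q then 0
     else neg_part (1 - q $ i / p $ i) * pos_part (p $ j - q $ j)
            / (\<Sum>k<dim_vec p. pos_part (p $ k - q $ k)))"

(* The eigenvalues of a real square matrix, taken in the complex numbers and counted with
   algebraic multiplicity. *)
definition eigenvalues :: "real mat \<Rightarrow> complex multiset" where
  "eigenvalues A = proots (char_poly (map_mat complex_of_real A))"

lemma set_mset_eigenvalues:
  assumes "A \<in> carrier_mat n n"
  shows "set_mset (eigenvalues A) = {x. eigenvalue (map_mat complex_of_real A) x}"
proof -
  have A: "map_mat complex_of_real A \<in> carrier_mat n n"
    using assms by simp
  have "char_poly (map_mat complex_of_real A) \<noteq> 0"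
    using degree_monic_char_poly[OF A] by auto
  then show ?thesis
    by (simp add: eigenvalues_def eigenvalue_root_char_poly[OF A])
qed

lemma size_eigenvalues:
  assumes "A \<in> carrier_mat n n"
  shows "size (eigenvalues A) = n"
  using degree_monic_char_poly[of "map_mat complex_of_real A" n] assms
  by (simp add: eigenvalues_def size_proots_complex)

end

theory Submission
  imports Defs
begin

text \<open>
  Put \<open>S = {i. p\<^sub>i > q\<^sub>i}\<close>. If \<open>p = q\<close>, both matrices are diagonal.
  Otherwise, in both of them, an off-diagonal entry \<open>(i, j)\<close> carries a factor
  that vanishes unless \<open>p\<^sub>i < q\<^sub>i\<close> and a factor \<open>[p\<^sub>j - q\<^sub>j]\<^sup>+\<close> that vanishes unless
  \<open>j \<in> S\<close>. Hence the off-diagonal support only leads from the complement of \<open>S\<close> into \<open>S\<close>, so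
  it contains no two consecutive steps (listing \<open>S\<close> last makes the matrix upper
  triangular). A permutation other than the identity moves some \<open>i\<close> and then also
  moves the image of \<open>i\<close>, so its Leibniz term contains two consecutive off-diagonal
  entries and vanishes. The determinant is therefore the product of the diagonal
  (\<open>det_eq_prod_diag_if_no_consecutive_entries\<close>); applied to the characteristic matrix,
  which has the same off-diagonal support, this splits the characteristic polynomial into
  the linear factors given by the diagonal
  (\<open>eigenvalues_eq_diag_if_no_consecutive_entries\<close>).
\<close>

text \<open>
  Read the hypothesis as: the digraph of off-diagonal nonzero entries has no walk of length two.
  A non-identity permutation would need such a walk, because each of its nontrivial cycles
  consists of at least two steps.
\<close>

lemma det_eq_prod_diag_if_no_consecutive_entries:
  fixes A :: "'a :: comm_ring_1 mat"
  assumes A: "A \<in> carrier_mat n n"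
    and no_walk: "\<And>i j k. \<lbrakk>i < n; j < n; k < n; i \<noteq> j; j \<noteq> k\<rbrakk>
                    \<Longrightarrow> A $$ (i, j) = 0 \<or> A $$ (j, k) = 0"
  shows "det A = (\<Prod>i<n. A $$ (i, i))"
proof -
  let ?term = "\<lambda>\<pi>. signof \<pi> * (\<Prod>i = 0..<n. A $$ (i, \<pi> i))"
  let ?P = "{\<pi>. \<pi> permutes {0..<n}}"
  have vanish: "?term \<pi> = 0" if "\<pi> \<in> ?P - {id}" for \<pi>
  proof -
    have perm: "\<pi> permutes {0..<n}" and "\<pi> \<noteq> id"
      using that by auto
    then obtain i where moved: "\<pi> i \<noteq> i"
      by (auto simp: fun_eq_iff)
    have i: "i < n"
      using perm moved by (auto simp: permutes_def)
    have in_range: "\<pi> j < n" if "j < n" for j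
      using permutes_in_image[OF perm, of j] that by simp
    have moved': "\<pi> (\<pi> i) \<noteq> \<pi> i"
      using moved permutes_inj[OF perm] by (auto dest: injD)
    have "A $$ (i, \<pi> i) = 0 \<or> A $$ (\<pi> i, \<pi> (\<pi> i)) = 0"
      using no_walk[of i "\<pi> i" "\<pi> (\<pi> i)"] i in_range moved moved' by metis
    then have "\<exists>j\<in>{0..<n}. A $$ (j, \<pi> j) = 0"
      using i in_range[OF i] by auto
    then have "(\<Prod>i = 0..<n. A $$ (i, \<pi> i)) = 0"
      by (intro prod_zero) auto
    then show ?thesis
      by simp
  qed
  have "det A = sum ?term ?P"
    by (rule det_def'[OF A])
  also have "\<dots> = sum ?term {id}"
    using vanish by (intro sum.mono_neutral_right) (auto simp: finite_permutations permutes_id)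
  also have "\<dots> = (\<Prod>i<n. A $$ (i, i))"
    by (simp add: atLeast0LessThan)
  finally show ?thesis .
qed

lemma char_poly_eq_prod_diag_if_no_consecutive_entries:
  fixes A :: "'a :: comm_ring_1 mat"
  assumes A: "A \<in> carrier_mat n n"
    and no_walk: "\<And>i j k. \<lbrakk>i < n; j < n; k < n; i \<noteq> j; j \<noteq> k\<rbrakk>
                    \<Longrightarrow> A $$ (i, j) = 0 \<or> A $$ (j, k) = 0"
  shows "char_poly A = (\<Prod>i<n. [:- A $$ (i, i), 1:])"
proof -
  have entry: "char_poly_matrix A $$ (i, j) = (if i = j then [:- A $$ (i, i), 1:] else [:- A $$ (i, j):])"
    if "i < n" "j < n" for i j
    using A that by (auto simp: char_poly_matrix_def)
  have "char_poly A = (\<Prod>i<n. char_poly_matrix A $$ (i, i))"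
    unfolding char_poly_def
  proof (rule det_eq_prod_diag_if_no_consecutive_entries)
    show "char_poly_matrix A \<in> carrier_mat n n"
      using A by simp
  next
    fix i j k
    assume ijk: "i < n" "j < n" "k < n" "i \<noteq> j" "j \<noteq> k"
    show "char_poly_matrix A $$ (i, j) = 0 \<or> char_poly_matrix A $$ (j, k) = 0"
      using no_walk[OF ijk] ijk by (auto simp: entry)
  qed
  then show ?thesis
    by (simp add: entry)
qed

lemma eigenvalues_eq_diag_if_no_consecutive_entries:
  assumes A: "A \<in> carrier_mat n n"
    and no_walk: "\<And>i j k. \<lbrakk>i < n; j < n; k < n; i \<noteq> j; j \<noteq> k\<rbrakk>
                    \<Longrightarrow> A $$ (i, j) = 0 \<or> A $$ (j, k) = 0"
  shows "eigenvalues A = {# complex_of_real (A $$ (i, i)). i \<in># mset_set {..<n} #}"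
proof -
  let ?C = "map_mat complex_of_real A"
  have "char_poly ?C = (\<Prod>i<n. [:- ?C $$ (i, i), 1:])"
  proof (rule char_poly_eq_prod_diag_if_no_consecutive_entries)
    show "?C \<in> carrier_mat n n"
      using A by simp
  next
    fix i j k
    assume ijk: "i < n" "j < n" "k < n" "i \<noteq> j" "j \<noteq> k"
    show "?C $$ (i, j) = 0 \<or> ?C $$ (j, k) = 0"
      using no_walk[OF ijk] ijk A by auto
  qed
  also have "\<dots> = (\<Prod>i<n. [:- complex_of_real (A $$ (i, i)), 1:])"
    using A by (intro prod.cong) auto
  finally have "eigenvalues A = (\<Sum>i<n. proots [:- complex_of_real (A $$ (i, i)), 1:])"
    by (simp add: eigenvalues_def proots_prod)
  also have "\<dots> = (\<Sum>i<n. {# complex_of_real (A $$ (i, i)) #})"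
    by (simp add: proots_linear_factor)
  also have "\<dots> = {# complex_of_real (A $$ (i, i)). i \<in># mset_set {..<n} #}"
    by (induction n) (auto simp: lessThan_Suc)
  finally show ?thesis .
qed

text \<open>
  A nonzero off-diagonal entry in column \<open>j\<close> forces \<open>p\<^sub>j > q\<^sub>j\<close>, and then the row \<open>j\<close> is zero
  off the diagonal.
\<close>

lemma U_bar_no_consecutive_entries:
  assumes "i < dim_vec p" "j < dim_vec p" "k < dim_vec p" "i \<noteq> j" "j \<noteq> k"
    and pos: "q $ j > 0"
  shows "U_bar p q $$ (i, j) = 0 \<or> U_bar p q $$ (j, k) = 0"
proof (cases "p $ j \<le> q $ j")
  case True
  then have "pos_part (p $ j - q $ j) = 0"
    by (simp add: pos_part_def)
  then show ?thesis
    using assms by (simp add: U_bar_def)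
next
  case False
  then have "pos_part (1 - p $ j / q $ j) = 0"
    using pos by (simp add: pos_part_def field_simps)
  then show ?thesis
    using assms by (simp add: U_bar_def)
qed

lemma V_bar_no_consecutive_entries:
  assumes "i < dim_vec p" "j < dim_vec p" "k < dim_vec p" "i \<noteq> j" "j \<noteq> k"
    and pos: "p $ j > 0"
  shows "V_bar p q $$ (i, j) = 0 \<or> V_bar p q $$ (j, k) = 0"
proof (cases "p $ j \<le> q $ j")
  case True
  then have "pos_part (p $ j - q $ j) = 0"
    by (simp add: pos_part_def)
  then show ?thesis
    using assms by (simp add: V_bar_def)
next
  case False
  then have "neg_part (1 - q $ j / p $ j) = 0"
    using pos by (simp add: neg_part_def field_simps)
  then show ?thesis
    using assms by (simp add: V_bar_def)
qed

theorem theorem14: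
  fixes n :: nat and p q :: "real vec"
  assumes "n \<ge> 1"
    and "p \<in> carrier_vec n" and "q \<in> carrier_vec n"
    and "stochastic_vec p" and "stochastic_vec q"
    and "positive_vec p" and "positive_vec q"
  shows "eigenvalues (U_bar p q) =
           {# complex_of_real (U_bar p q $$ (i, i)). i \<in># mset_set {..<n} #} \<and>
         eigenvalues (V_bar p q) =
           {# complex_of_real (V_bar p q $$ (i, i)). i \<in># mset_set {..<n} #}"
proof
  have dim: "dim_vec p = n" "dim_vec q = n"
    using assms by auto
  have pos: "p $ j > 0" "q $ j > 0" if "j < n" for j
    using assms that dim by (auto simp: positive_vec_def)
  show "eigenvalues (U_bar p q) =
          {# complex_of_real (U_bar p q $$ (i, i)). i \<in># mset_set {..<n} #}"
  proof (rule eigenvalues_eq_diag_if_no_consecutive_entries)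
    show "U_bar p q \<in> carrier_mat n n"
      by (simp add: U_bar_def dim)
  qed (rule U_bar_no_consecutive_entries; simp add: dim pos)
  show "eigenvalues (V_bar p q) =
          {# complex_of_real (V_bar p q $$ (i, i)). i \<in># mset_set {..<n} #}"
  proof (rule eigenvalues_eq_diag_if_no_consecutive_entries)
    show "V_bar p q \<in> carrier_mat n n"
      by (simp add: V_bar_def dim)
  qed (rule V_bar_no_consecutive_entries; simp add: dim pos)
qed

end
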